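(* Let $b$ and $w$ be integers with $b>w\ge 1$. If a Pólya urn is started with $b$ black and $w$ white balls, then the probability that the number of black balls and the number of white balls will ever be equal, i.e. $P(\exists\, n\ge 0:\ B_n=W_n)$, is twice the probability that in $b+w-1$ independent tosses of a fair coin, no more than $w-1$ will be heads.
   Context: Pólya urn: the urn initially contains $B_0=b$ black and $W_0=w$ white balls. At each step a ball is drawn uniformly at random from the urn and is then replaced with two balls of the same color (so the net effect is to add one ball of the drawn color); this is repeated indefinitely. $B_n$ and $W_n$ denote the numbers of black and white balls after $n$ draws, so $B_n+W_n=b+w+n$, and conditionally on the first $n$ draws, draw $n+1$ is black with probability $B_n/(b+w+n)$ and white with probability $W_n/(b+w+n)$. *)

theory Defs
  imports "HOL-Probability.Probability"
begin

datatype colour = Black | White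

text \<open>Number of balls of colour \<^term>\<open>c\<close> after \<^term>\<open>n\<close> draws, when there are \<^term>\<open>k\<close> of them
  initially and draw number \<^term>\<open>n + 1\<close> has colour \<^term>\<open>d n\<close>.\<close>

primrec balls :: "nat \<Rightarrow> colour \<Rightarrow> (nat \<Rightarrow> colour) \<Rightarrow> nat \<Rightarrow> nat" where
  "balls k c d 0 = k"
| "balls k c d (Suc n) = balls k c d n + (if d n = c then 1 else 0)"

text \<open>A Polya urn is given by the random sequence of drawn colours, on an arbitrary probability
  space. Since \<^const>\<open>cond_prob\<close> is 0 when the condition has probability 0, the two
  laws are only required for histories \<^term>\<open>h\<close> of positive probability.\<close>

locale polya_urn = prob_space M for M :: "'a measure" +
  fixes b w :: nat and D :: "nat \<Rightarrow> 'a \<Rightarrow> colour"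
  assumes draw_measurable: "\<And>n. D n \<in> measurable M (count_space UNIV)"
    and draw_black: "\<And>n h. \<P>(x in M. \<forall>i<n. D i x = h i) > 0 \<Longrightarrow>
      \<P>(x in M. D n x = Black \<bar> \<forall>i<n. D i x = h i) = real (balls b Black h n) / real (b + w + n)"
    and draw_white: "\<And>n h. \<P>(x in M. \<forall>i<n. D i x = h i) > 0 \<Longrightarrow>
      \<P>(x in M. D n x = White \<bar> \<forall>i<n. D i x = h i) = real (balls w White h n) / real (b + w + n)"

definition black_balls :: "nat \<Rightarrow> (nat \<Rightarrow> 'a \<Rightarrow> colour) \<Rightarrow> nat \<Rightarrow> 'a \<Rightarrow> nat" where
  "black_balls b D n x = balls b Black (\<lambda>i. D i x) n"

definition white_balls :: "nat \<Rightarrow> (nat \<Rightarrow> 'a \<Rightarrow> colour) \<Rightarrow> nat \<Rightarrow> 'a \<Rightarrow> nat" where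
  "white_balls w D n x = balls w White (\<lambda>i. D i x) n"

text \<open>The joint law of \<^term>\<open>m\<close> independent tosses of a fair coin; \<^const>\<open>True\<close> is heads, and the
  value outside \<^term>\<open>{..<m}\<close> is the irrelevant default \<^const>\<open>False\<close>.\<close>

definition fair_tosses :: "nat \<Rightarrow> (nat \<Rightarrow> bool) pmf" where
  "fair_tosses m = Pi_pmf {..<m} False (\<lambda>_. bernoulli_pmf (1 / 2))"

end

theory Submission
  imports Defs
begin

text \<open>
  Let \<open>u(B, W)\<close> be twice the probability that \<open>B + W - 1\<close> fair tosses show fewer than \<open>W\<close> heads.
  By the symmetry of the coin \<open>u = 1\<close> on the diagonal \<open>B = W\<close>, and an extra toss together with
  \<open>W * (N choose W) = B * (N choose (W - 1))\<close>, where \<open>N = B + W - 1\<close>, shows that \<open>u\<close> is harmonic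
  for the urn (lemma \<open>tie_chance_harmonic\<close>). So \<open>u\<close> along the urn, frozen at the first tie, is a
  martingale: for every \<open>n\<close>, \<open>u(b, w)\<close> is the probability of a tie by time \<open>n\<close> plus the
  expectation of \<open>u(B_n, W_n)\<close> over the outcomes without a tie by time \<open>n\<close>.

  It remains to see that the last term vanishes in the limit. If no tie has occurred then
  \<open>W_n < B_n\<close>, so the term is a sum over states \<open>j = W_n\<close> below the diagonal. Two estimates suffice,
  with \<open>N = b + w + n - 1\<close>: no single state has probability above \<open>(b + w - 1) / N\<close>
  (lemma \<open>white_law_bound\<close>), and the values of \<open>u\<close> below the diagonal add up to at most \<open>sqrt N\<close>
  (lemma \<open>sum_heads_below_le\<close>), because only about \<open>sqrt N\<close> states lie within the fluctuations of
  \<open>N\<close> tosses. The product of the bounds is of order \<open>1 / sqrt N\<close>.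

  All expectations up to time \<open>n\<close> are finite sums over draw histories of length \<open>n\<close>, weighted by
  the product of the conditional draw probabilities. The measure space enters only
  through the probabilities of these histories and, for the event of ever being tied, through
  continuity from below.
\<close>


section \<open>Binomial tails at one half\<close>

definition heads_below :: "nat \<Rightarrow> nat \<Rightarrow> real" where
  "heads_below N m = (\<Sum>k<m. real (N choose k)) / 2 ^ N"

lemma prob_fair_tosses:
  assumes "w \<ge> 1"
  shows "\<P>(t in fair_tosses N. card {i. i < N \<and> t i} \<le> w - 1) = heads_below N w"
proof -
  have "binomial_pmf N (1/2) = map_pmf (\<lambda>t. card {i \<in> {..<N}. t i}) (fair_tosses N)"
    unfolding fair_tosses_def by (rule binomial_pmf_altdef') auto
  then have "\<P>(t in fair_tosses N. card {i. i < N \<and> t i} \<le> w - 1)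
      = measure_pmf.prob (binomial_pmf N (1/2)) {..<w}"
    using assms by (auto simp: vimage_def intro!: arg_cong[where f = "measure_pmf.prob _"])
  also have "\<dots> = (\<Sum>k<w. pmf (binomial_pmf N (1/2)) k)"
    by (simp add: measure_measure_pmf_finite)
  also have "\<dots> = (\<Sum>k<w. real (N choose k) / 2 ^ N)"
  proof (rule sum.cong)
    fix k
    show "pmf (binomial_pmf N (1/2)) k = real (N choose k) / 2 ^ N"
    proof (cases "k \<le> N")
      case True
      then have "(1/2::real) ^ k * (1/2) ^ (N - k) = 1 / 2 ^ N"
        by (simp add: power_divide flip: power_add)
      then show ?thesis by (simp add: mult.assoc)
    qed (simp add: binomial_eq_0)
  qed simp
  finally show ?thesis by (simp add: heads_below_def sum_divide_distrib)
qed

lemma heads_below_nonneg: "heads_below N m \<ge> 0"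
  by (simp add: heads_below_def sum_nonneg)

text \<open>One more toss pushes the count from \<open>m\<close> to \<open>m + 1\<close> exactly when it shows heads and the
  count stood at \<open>m\<close>; this half of the mass at \<open>m\<close> is what the tail loses.\<close>

lemma heads_below_toss:
  "heads_below (Suc N) (Suc m) = heads_below N (Suc m) - real (N choose m) / 2 ^ Suc N"
proof -
  have "(\<Sum>k<Suc m. real (Suc N choose k)) = 2 * (\<Sum>k<Suc m. real (N choose k)) - real (N choose m)"
    by (induction m) auto
  then show ?thesis by (simp add: heads_below_def field_simps del: sum.lessThan_Suc)
qed

lemma heads_below_Suc: "heads_below N (Suc m) = heads_below N m + real (N choose m) / 2 ^ N"
  by (simp add: heads_below_def add_divide_distrib)

text \<open>With an odd number of tosses, one side has the majority, and each side is equally likely to have it.\<close>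

lemma heads_below_symmetric: "heads_below (2 * m + 1) (Suc m) = 1 / 2"
proof -
  have "(\<Sum>k<Suc m. real ((2 * m + 1) choose k)) = real (\<Sum>k\<le>m. (2 * m + 1) choose k)"
    by (simp only: lessThan_Suc_atMost of_nat_sum)
  also have "\<dots> = 2 ^ (2 * m)"
    by (simp only: binomial_r_part_sum) simp
  finally show ?thesis by (simp add: heads_below_def)
qed

lemma binomial_second_moment:
  "(\<Sum>k\<le>N. real (N choose k) / 2 ^ N * (real N - 2 * real k)\<^sup>2) = real N"
proof -
  have B: "Bernstein N k (1/2) = real (N choose k) / 2 ^ N" if "k \<le> N" for k
    using that by (simp add: Bernstein_def power_divide mult.assoc flip: power_add)
  have "(\<Sum>k\<le>N. real (N choose k) / 2 ^ N * (real N - 2 * real k)\<^sup>2)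
      = (\<Sum>k\<le>N. 4 * (real k * (real k - 1) * Bernstein N k (1/2))
          + (4 - 4 * real N) * (real k * Bernstein N k (1/2)) + (real N)\<^sup>2 * Bernstein N k (1/2))"
  proof (rule sum.cong)
    fix k assume "k \<in> {..N}"
    then have "real (N choose k) / 2 ^ N = Bernstein N k (1/2)" by (simp add: B)
    then show "real (N choose k) / 2 ^ N * (real N - 2 * real k)\<^sup>2
        = 4 * (real k * (real k - 1) * Bernstein N k (1/2))
          + (4 - 4 * real N) * (real k * Bernstein N k (1/2)) + (real N)\<^sup>2 * Bernstein N k (1/2)"
      by (simp only:) (simp add: power2_eq_square algebra_simps)
  qed simp
  also have "\<dots> = 4 * (real N * (real N - 1) * (1/2)\<^sup>2) + (4 - 4 * real N) * (real N * (1/2))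
      + (real N)\<^sup>2"
    by (simp only: sum.distrib sum_distrib_left[symmetric] sum_kk_Bernstein sum_k_Bernstein
        sum_Bernstein mult_1_right)
  also have "\<dots> = real N"
    by (simp add: power2_eq_square algebra_simps)
  finally show ?thesis .
qed

text \<open>Jensen's inequality for the square root would give this from the second moment; the
  arithmetic-geometric mean inequality applied to each summand does the same.\<close>

lemma binomial_mean_deviation:
  assumes "N > 0"
  shows "(\<Sum>k\<le>N. real (N choose k) / 2 ^ N * \<bar>real N - 2 * real k\<bar>) \<le> sqrt (real N)"
proof -
  have s: "sqrt (real N) > 0" using assms by simp
  have amgm: "\<bar>x\<bar> \<le> sqrt (real N) / 2 + x\<^sup>2 / (2 * sqrt (real N))" for x :: real
  proof -
    have "0 \<le> (sqrt (real N) - \<bar>x\<bar>)\<^sup>2" by simp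
    then have "2 * sqrt (real N) * \<bar>x\<bar> \<le> sqrt (real N) * sqrt (real N) + x\<^sup>2"
      by (simp add: power2_eq_square algebra_simps)
    then show ?thesis using s by (simp add: field_simps power2_eq_square)
  qed
  have total: "(\<Sum>k\<le>N. real (N choose k) / 2 ^ N) = 1"
  proof -
    have "(\<Sum>k\<le>N. real (N choose k)) = 2 ^ N"
      by (simp only: of_nat_sum[symmetric] choose_row_sum) simp
    then show ?thesis by (simp flip: sum_divide_distrib)
  qed
  have "(\<Sum>k\<le>N. real (N choose k) / 2 ^ N * \<bar>real N - 2 * real k\<bar>)
      \<le> (\<Sum>k\<le>N. real (N choose k) / 2 ^ N *
            (sqrt (real N) / 2 + (real N - 2 * real k)\<^sup>2 / (2 * sqrt (real N))))"
    by (intro sum_mono mult_left_mono amgm) auto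
  also have "\<dots> = (\<Sum>k\<le>N. real (N choose k) / 2 ^ N) * (sqrt (real N) / 2)
      + (\<Sum>k\<le>N. real (N choose k) / 2 ^ N * (real N - 2 * real k)\<^sup>2) / (2 * sqrt (real N))"
    by (simp add: sum_distrib_right sum_divide_distrib distrib_left sum.distrib)
  also have "\<dots> = sqrt (real N) / 2 + real N / (2 * sqrt (real N))"
    by (simp only: total binomial_second_moment mult_1_left)
  also have "\<dots> = sqrt (real N)"
    using s by (simp add: field_simps flip: power2_eq_square)
  finally show ?thesis .
qed

text \<open>Exchanging the order of summation, outcome \<open>k\<close> is counted twice for every \<open>j\<close> with
  \<open>k < j \<le> N / 2\<close>, hence at most \<open>\<bar>N - 2 * k\<bar>\<close> times, and the sum is at most the mean
  absolute difference between the numbers of heads and tails.\<close>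

lemma sum_heads_below_le:
  assumes "N > 0"
  shows "(\<Sum>j | 2 * j \<le> N. 2 * heads_below N j) \<le> sqrt (real N)"
proof -
  define p where "p k = real (N choose k) / 2 ^ N" for k
  have p0: "p k \<ge> 0" for k by (simp add: p_def)
  have fin: "finite {j. 2 * j \<le> N}" by (rule finite_subset[of _ "{..N}"]) auto
  have count: "2 * real (card {j. k < j \<and> 2 * j \<le> N}) \<le> \<bar>real N - 2 * real k\<bar>" for k
  proof -
    have "{j. k < j \<and> 2 * j \<le> N} = {k<..N div 2}" by auto
    then have "2 * card {j. k < j \<and> 2 * j \<le> N} \<le> N - 2 * k" by simp
    then show ?thesis by linarith
  qed
  have "(\<Sum>j | 2 * j \<le> N. 2 * heads_below N j)
      = (\<Sum>j | 2 * j \<le> N. \<Sum>k\<le>N. 2 * p k * (if k < j then 1 else 0))"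
  proof (rule sum.cong)
    fix j assume j: "j \<in> {j. 2 * j \<le> N}"
    have "heads_below N j = (\<Sum>k<j. p k)"
      by (simp add: heads_below_def p_def sum_divide_distrib)
    also have "\<dots> = (\<Sum>k\<in>{k \<in> {..N}. k < j}. p k)"
      using j by (intro sum.cong) auto
    also have "\<dots> = (\<Sum>k\<le>N. p k * (if k < j then 1 else 0))"
      by (subst sum.inter_filter) (auto intro!: sum.cong)
    finally show "2 * heads_below N j = (\<Sum>k\<le>N. 2 * p k * (if k < j then 1 else 0))"
      by (simp add: sum_distrib_left mult.assoc)
  qed simp
  also have "\<dots> = (\<Sum>k\<le>N. \<Sum>j | 2 * j \<le> N. 2 * p k * (if k < j then 1 else 0))"
    by (rule sum.swap)
  also have "\<dots> = (\<Sum>k\<le>N. p k * (2 * real (card {j. k < j \<and> 2 * j \<le> N})))"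
  proof (rule sum.cong)
    fix k
    have "(\<Sum>j | 2 * j \<le> N. (if k < j then 1 else 0 :: real))
        = real (card {j. k < j \<and> 2 * j \<le> N})"
      using fin by (simp add: sum.If_cases Int_def conj_commute)
    then show "(\<Sum>j | 2 * j \<le> N. 2 * p k * (if k < j then 1 else 0))
        = p k * (2 * real (card {j. k < j \<and> 2 * j \<le> N}))"
      unfolding sum_distrib_left[symmetric] by simp
  qed simp
  also have "\<dots> \<le> (\<Sum>k\<le>N. p k * \<bar>real N - 2 * real k\<bar>)"
    by (intro sum_mono mult_left_mono count p0)
  also have "\<dots> \<le> sqrt (real N)"
    using binomial_mean_deviation[OF assms] by (simp add: p_def)
  finally show ?thesis .
qed


section \<open>A harmonic function of the urn\<close>

definition tie_chance :: "nat \<Rightarrow> nat \<Rightarrow> real" where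
  "tie_chance B W = 2 * heads_below (B + W - 1) W"

lemma tie_chance_nonneg: "tie_chance B W \<ge> 0"
  by (simp add: tie_chance_def heads_below_nonneg)

lemma tie_chance_diagonal:
  assumes "k \<ge> 1"
  shows "tie_chance k k = 1"
proof -
  obtain m where "k = Suc m" using assms by (cases k) auto
  then show ?thesis using heads_below_symmetric[of m]
    by (simp add: tie_chance_def flip: mult_2)
qed

text \<open>Drawing black moves the number of tosses from \<open>N = B + W - 1\<close> to \<open>N + 1\<close> with the same
  threshold and lowers the value by half the mass at \<open>W - 1\<close> (doubled); drawing white also raises
  the threshold and increases the value by half the mass at \<open>W\<close> (doubled). The weights \<open>B\<close> and
  \<open>W\<close> balance these two changes by the absorption identities for binomial coefficients.\<close>

lemma tie_chance_harmonic:
  assumes "B \<ge> 1" "W \<ge> 1"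
  shows "real B / real (B + W) * tie_chance (Suc B) W
    + real W / real (B + W) * tie_chance B (Suc W) = tie_chance B W"
proof -
  obtain m where W: "W = Suc m" using assms by (cases W) auto
  define N where "N = B + m"
  define x where "x = heads_below N (Suc m)"
  define y where "y = 1 / (2::real) ^ Suc N"
  have u: "tie_chance B W = 2 * x"
    by (simp add: tie_chance_def W N_def x_def)
  have u1: "tie_chance (Suc B) W = 2 * (x - real (N choose m) * y)"
    using heads_below_toss[of N m] by (simp add: tie_chance_def W N_def x_def y_def)
  have u2: "tie_chance B (Suc W) = 2 * (x + real (N choose W) * y)"
    using heads_below_toss[of N W] heads_below_Suc[of N W]
    by (simp add: tie_chance_def W N_def x_def y_def field_simps)
  have "W * (N choose W) = B * (N choose m)"
    using binomial_absorb_comp[of N m] binomial_absorption[of m N] assms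
    by (cases N) (auto simp: W N_def)
  then have bal: "real W * real (N choose W) = real B * real (N choose m)"
    by (metis of_nat_mult)
  have "real B * tie_chance (Suc B) W + real W * tie_chance B (Suc W)
      = 2 * x * (real B + real W) + 2 * y * (real W * real (N choose W) - real B * real (N choose m))"
    by (simp add: u1 u2 algebra_simps)
  also have "\<dots> = tie_chance B W * real (B + W)" by (simp add: bal u)
  finally have "(real B * tie_chance (Suc B) W + real W * tie_chance B (Suc W)) / real (B + W)
      = tie_chance B W"
    using assms by simp
  then show ?thesis by (simp add: add_divide_distrib)
qed


section \<open>Finite draw histories\<close>

text \<open>Extensional functions make the set of histories finite and the representation of each
  history unique; only values below \<open>n\<close> are meaningful.\<close>

definition histories :: "nat \<Rightarrow> (nat \<Rightarrow> colour) set" where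
  "histories n = {..<n} \<rightarrow>\<^sub>E UNIV"

lemma UNIV_colour: "UNIV = {Black, White}"
  using colour.exhaust by auto

lemma finite_histories: "finite (histories n)"
  unfolding histories_def by (intro finite_PiE) (auto simp: UNIV_colour)

lemma sum_histories_0: "(\<Sum>h\<in>histories 0. g h) = g (\<lambda>_. undefined)"
  by (simp add: histories_def)

lemma sum_histories_Suc:
  "(\<Sum>h\<in>histories (Suc n). g h)
     = (\<Sum>h\<in>histories n. g (h(n := Black)) + g (h(n := White)) :: real)"
proof -
  have "histories (Suc n) = (\<lambda>(c, h). h(n := c)) ` (UNIV \<times> histories n)"
    by (simp add: histories_def lessThan_Suc PiE_insert_eq)
  moreover have "inj_on (\<lambda>(c, h). h(n := c)) (UNIV \<times> histories n)"
    unfolding histories_def by (rule inj_combinator) simp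
  ultimately have "(\<Sum>h\<in>histories (Suc n). g h) = (\<Sum>(c, h)\<in>UNIV \<times> histories n. g (h(n := c)))"
    by (simp add: sum.reindex case_prod_unfold o_def)
  also have "\<dots> = (\<Sum>c\<in>UNIV. \<Sum>h\<in>histories n. g (h(n := c)))"
    by (simp add: sum.cartesian_product)
  finally show ?thesis by (simp add: UNIV_colour sum.distrib)
qed

definition determined_by :: "nat \<Rightarrow> ((nat \<Rightarrow> colour) \<Rightarrow> bool) \<Rightarrow> bool" where
  "determined_by n Q \<longleftrightarrow> (\<forall>h h'. (\<forall>i<n. h i = h' i) \<longrightarrow> Q h = Q h')"

lemma balls_cong:
  assumes "\<And>i. i < n \<Longrightarrow> h i = h' i"
  shows "balls k c h n = balls k c h' n"
  using assms by (induction n) auto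

lemma balls_fun_upd: "m \<le> n \<Longrightarrow> balls k c (h(n := d)) m = balls k c h m"
  by (rule balls_cong) auto

lemma balls_ge: "balls k c h n \<ge> k"
  by (induction n) auto

lemma balls_total: "balls b Black h n + balls w White h n = b + w + n"
proof (induction n)
  case (Suc n)
  then show ?case by (cases "h n") auto
qed simp

text \<open>The probability, under the urn's law, that the first \<open>n\<close> draws follow \<open>h\<close>
  (lemma \<open>prob_cylinder\<close>).\<close>

primrec urn_weight :: "nat \<Rightarrow> nat \<Rightarrow> nat \<Rightarrow> (nat \<Rightarrow> colour) \<Rightarrow> real" where
  "urn_weight b w 0 h = 1"
| "urn_weight b w (Suc n) h = urn_weight b w n h *
     (real (balls (if h n = Black then b else w) (h n) h n) / real (b + w + n))"

lemma urn_weight_nonneg: "urn_weight b w n h \<ge> 0"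
  by (induction n) auto

lemma urn_weight_cong:
  assumes "\<And>i. i < n \<Longrightarrow> h i = h' i"
  shows "urn_weight b w n h = urn_weight b w n h'"
  using assms
proof (induction n)
  case (Suc n)
  then show ?case using balls_cong[of n h h'] by auto
qed simp

text \<open>The expectation of a function of the first \<open>n\<close> draws, defined without a probability space
  so that the estimates below are about finite sums.\<close>

definition urn_mean :: "nat \<Rightarrow> nat \<Rightarrow> nat \<Rightarrow> ((nat \<Rightarrow> colour) \<Rightarrow> real) \<Rightarrow> real" where
  "urn_mean b w n g = (\<Sum>h\<in>histories n. urn_weight b w n h * g h)"

lemma urn_mean_0: "urn_mean b w 0 g = g (\<lambda>_. undefined)"
  by (simp add: urn_mean_def sum_histories_0)

text \<open>The tower property: condition on the first \<open>n\<close> draws and average over the next one. Every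
  induction over time below rests on it.\<close>

lemma urn_mean_Suc:
  "urn_mean b w (Suc n) g = urn_mean b w n (\<lambda>h.
     real (balls b Black h n) / real (b + w + n) * g (h(n := Black)) +
     real (balls w White h n) / real (b + w + n) * g (h(n := White)))"
proof -
  have "urn_weight b w n (h(n := c)) = urn_weight b w n h" for h c
    by (rule urn_weight_cong) auto
  then show ?thesis
    unfolding urn_mean_def sum_histories_Suc
    by (intro sum.cong) (auto simp: balls_fun_upd algebra_simps)
qed

lemma urn_mean_mono:
  assumes "\<And>h. f h \<le> g h"
  shows "urn_mean b w n f \<le> urn_mean b w n g"
  unfolding urn_mean_def by (intro sum_mono mult_left_mono assms urn_weight_nonneg)

lemma urn_mean_add: "urn_mean b w n (\<lambda>h. f h + g h) = urn_mean b w n f + urn_mean b w n g"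
  by (simp add: urn_mean_def distrib_left sum.distrib)

lemma urn_mean_cmult: "urn_mean b w n (\<lambda>h. c * g h) = c * urn_mean b w n g"
  by (simp add: urn_mean_def sum_distrib_left algebra_simps)

lemma urn_mean_sum: "urn_mean b w n (\<lambda>h. \<Sum>j\<in>J. g j h) = (\<Sum>j\<in>J. urn_mean b w n (g j))"
  unfolding urn_mean_def sum_distrib_left by (rule sum.swap)


section \<open>No state is too likely\<close>

text \<open>With \<open>S = b + w + n\<close> balls, the state with \<open>j\<close> white balls after the next draw is entered
  from \<open>j\<close> with probability \<open>(S - j) / S\<close> and from \<open>j - 1\<close> with probability \<open>(j - 1) / S\<close>. These
  coefficients add up to \<open>(S - 1) / S\<close>, so the largest state probability shrinks by that factor
  at every draw, and the product telescopes. The urn's self-reinforcement is what spreads the law so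
  evenly.\<close>

lemma white_law_bound:
  assumes "b \<ge> 1" "w \<ge> 1"
  shows "urn_mean b w n (\<lambda>h. of_bool (balls w White h n = j))
    \<le> real (b + w - 1) / real (b + w + n - 1)"
proof (induction n arbitrary: j)
  case 0
  then show ?case using assms by (simp add: urn_mean_0)
next
  case (Suc n)
  define S where "S = b + w + n"
  \<comment> \<open>There is at least one ball of each colour, so the states \<open>0\<close> and those above \<open>S\<close> are
    unreachable; they are separated because \<open>j - 1\<close> and \<open>S - j\<close> truncate there.\<close>
  have S: "S \<ge> 2" using assms by (simp add: S_def)
  define q where "q i = urn_mean b w n (\<lambda>h. of_bool (balls w White h n = i))" for i
  let ?g = "\<lambda>h. real (balls b Black h n) / real S * of_bool (balls w White h n = j)
      + real (balls w White h n) / real S * of_bool (Suc (balls w White h n) = j)"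
  have step: "urn_mean b w (Suc n) (\<lambda>h. of_bool (balls w White h (Suc n) = j)) = urn_mean b w n ?g"
    unfolding urn_mean_Suc S_def by (simp add: balls_fun_upd)
  have tot: "balls b Black h n = S - balls w White h n" "balls w White h n \<ge> 1"
    "balls w White h n < S" for h
    using balls_total[of b h n w] balls_ge[of w White h n] balls_ge[of b Black h n] assms
    by (auto simp: S_def)
  have "urn_mean b w n ?g \<le> real (b + w - 1) / real S"
  proof (cases "1 \<le> j \<and> j \<le> S")
    case True
    have "?g = (\<lambda>h. real (S - j) / real S * of_bool (balls w White h n = j)
      + real (j - 1) / real S * of_bool (balls w White h n = j - 1))"
      using True by (auto simp: fun_eq_iff tot(1))
    then have "urn_mean b w n ?g = real (S - j) / real S * q j + real (j - 1) / real S * q (j - 1)"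
      by (simp only: urn_mean_add urn_mean_cmult q_def)
    also have "\<dots> \<le> real (S - j) / real S * (real (b + w - 1) / real (S - 1))
        + real (j - 1) / real S * (real (b + w - 1) / real (S - 1))"
      unfolding q_def S_def by (intro add_mono mult_left_mono Suc.IH) auto
    also have "\<dots> = (real (S - j) + real (j - 1)) * (real (b + w - 1) / real (S - 1)) / real S"
      by (simp add: algebra_simps add_divide_distrib)
    also have "real (S - j) + real (j - 1) = real (S - 1)"
      using True by (simp add: of_nat_diff)
    finally show ?thesis using S by simp
  next
    case False
    have "?g h = 0" for h
      using False tot(2)[of h] tot(3)[of h] by (auto simp: not_le)
    then have "urn_mean b w n ?g = 0" by (simp add: urn_mean_def)
    then show ?thesis by simp
  qed
  then show ?case unfolding step S_def by simp
qed


section \<open>The stopped martingale\<close>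

definition tied :: "nat \<Rightarrow> nat \<Rightarrow> nat \<Rightarrow> (nat \<Rightarrow> colour) \<Rightarrow> bool" where
  "tied b w n h \<longleftrightarrow> (\<exists>m\<le>n. balls b Black h m = balls w White h m)"

lemma tied_Suc:
  "tied b w (Suc n) h \<longleftrightarrow> tied b w n h \<or> balls b Black h (Suc n) = balls w White h (Suc n)"
  by (auto simp: tied_def le_Suc_eq)

lemma determined_by_tied: "determined_by n (tied b w n)"
  unfolding determined_by_def
proof (intro allI impI)
  fix h h' :: "nat \<Rightarrow> colour" assume "\<forall>i<n. h i = h' i"
  then have "balls k c h m = balls k c h' m" if "m \<le> n" for k c m
    using that by (intro balls_cong) auto
  then show "tied b w n h = tied b w n h'" by (auto simp: tied_def)
qed

text \<open>The lead \<open>B - W\<close> changes by one at each draw, so it cannot change sign without vanishing.\<close>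

lemma not_tied_less:
  assumes "w < b" "\<not> tied b w n h"
  shows "balls w White h n < balls b Black h n"
  using assms(2)
proof (induction n)
  case (Suc n)
  then show ?case by (cases "h n") (auto simp: tied_Suc)
qed (use assms in simp)

text \<open>The value of the harmonic function at the first tie is \<open>1\<close>, so freezing it there leaves
  the indicator of a tie plus the running value on the untied histories.\<close>

definition stopped_chance :: "nat \<Rightarrow> nat \<Rightarrow> nat \<Rightarrow> (nat \<Rightarrow> colour) \<Rightarrow> real" where
  "stopped_chance b w n h =
    (if tied b w n h then 1 else tie_chance (balls b Black h n) (balls w White h n))"

lemma stopped_chance_Suc:
  assumes "w \<ge> 1" "\<not> tied b w n h"
  shows "stopped_chance b w (Suc n) h =
    tie_chance (balls b Black h (Suc n)) (balls w White h (Suc n))"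
proof (cases "balls b Black h (Suc n) = balls w White h (Suc n)")
  case True
  moreover have "1 \<le> balls w White h (Suc n)"
    using assms balls_ge le_trans by blast
  ultimately show ?thesis
    using tie_chance_diagonal by (simp add: stopped_chance_def tied_Suc del: balls.simps)
qed (simp add: stopped_chance_def tied_Suc assms del: balls.simps)

lemma stopped_chance_martingale:
  assumes "w < b" "w \<ge> 1"
  shows "urn_mean b w n (stopped_chance b w n) = tie_chance b w"
proof (induction n)
  case 0
  then show ?case using assms by (simp add: urn_mean_0 stopped_chance_def tied_def)
next
  case (Suc n)
  have "real (balls b Black h n) / real (b + w + n) * stopped_chance b w (Suc n) (h(n := Black)) +
        real (balls w White h n) / real (b + w + n) * stopped_chance b w (Suc n) (h(n := White))
      = stopped_chance b w n h" for h
  proof -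
    let ?B = "balls b Black h n" and ?W = "balls w White h n"
    have tot: "b + w + n = ?B + ?W" using balls_total[of b h n w] by simp
    have ge: "?B \<ge> 1" "?W \<ge> 1"
      using balls_ge[of b Black h n] balls_ge[of w White h n] assms by auto
    have upd: "tied b w n (h(n := c)) = tied b w n h" for c
      using determined_by_tied[of n b w] by (simp add: determined_by_def)
    show ?thesis
    proof (cases "tied b w n h")
      case True
      then have "stopped_chance b w (Suc n) (h(n := c)) = 1" for c
        by (simp add: stopped_chance_def tied_Suc upd)
      moreover have "real ?B / real (?B + ?W) + real ?W / real (?B + ?W) = 1"
        using ge by (simp flip: add_divide_distrib)
      ultimately show ?thesis using True by (simp add: stopped_chance_def tot)
    next
      case False
      then have "stopped_chance b w (Suc n) (h(n := Black)) = tie_chance (Suc ?B) ?W"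
        "stopped_chance b w (Suc n) (h(n := White)) = tie_chance ?B (Suc ?W)"
        using assms by (simp_all add: stopped_chance_Suc upd balls_fun_upd)
      then show ?thesis
        using False tie_chance_harmonic[OF ge] by (simp add: stopped_chance_def tot)
    qed
  qed
  then have "urn_mean b w (Suc n) (stopped_chance b w (Suc n))
      = urn_mean b w n (stopped_chance b w n)"
    by (simp only: urn_mean_Suc)
  then show ?case using Suc.IH by simp
qed

text \<open>The part of the martingale that has not been stopped. Its histories lie strictly below the
  diagonal, where the harmonic function has small total mass, and each state below the diagonal
  carries little probability.\<close>

lemma urn_mean_untied_le:
  assumes "w < b" "w \<ge> 1"
  defines "N \<equiv> \<lambda>n. b + w + n - 1"
  shows "urn_mean b w n (\<lambda>h. of_bool (\<not> tied b w n h) *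
      tie_chance (balls b Black h n) (balls w White h n)) \<le> real (b + w - 1) / sqrt (real (N n))"
proof -
  have pos: "N n > 0" using assms by (simp add: N_def)
  have fin: "finite {j. 2 * j \<le> N n}" by (rule finite_subset[of _ "{..N n}"]) auto
  have "urn_mean b w n (\<lambda>h. of_bool (\<not> tied b w n h) *
      tie_chance (balls b Black h n) (balls w White h n))
    \<le> urn_mean b w n (\<lambda>h. \<Sum>j | 2 * j \<le> N n. 2 * heads_below (N n) j * of_bool (balls w White h n = j))"
  proof (rule urn_mean_mono)
    fix h
    let ?R = "\<Sum>j | 2 * j \<le> N n. 2 * heads_below (N n) j * of_bool (balls w White h n = j)"
    show "of_bool (\<not> tied b w n h) * tie_chance (balls b Black h n) (balls w White h n) \<le> ?R"
    proof (cases "tied b w n h")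
      case True
      then show ?thesis by (simp add: sum_nonneg heads_below_nonneg)
    next
      case False
      from not_tied_less[OF assms(1) False]
      have "2 * balls w White h n \<le> N n" using balls_total[of b h n w] by (simp add: N_def)
      then have "?R = 2 * heads_below (N n) (balls w White h n)"
        using fin by (simp add: of_bool_def if_distrib sum.delta' cong: if_cong)
      then show ?thesis using False balls_total[of b h n w] by (simp add: tie_chance_def N_def)
    qed
  qed
  also have "\<dots> = (\<Sum>j | 2 * j \<le> N n. 2 * heads_below (N n) j *
      urn_mean b w n (\<lambda>h. of_bool (balls w White h n = j)))"
    by (simp only: urn_mean_sum urn_mean_cmult)
  also have "\<dots> \<le> (\<Sum>j | 2 * j \<le> N n. 2 * heads_below (N n) j * (real (b + w - 1) / real (N n)))"
    unfolding N_def using assms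
    by (intro sum_mono mult_left_mono white_law_bound) (auto simp: heads_below_nonneg)
  also have "\<dots> = (\<Sum>j | 2 * j \<le> N n. 2 * heads_below (N n) j) * (real (b + w - 1) / real (N n))"
    by (rule sum_distrib_right[symmetric])
  also have "\<dots> \<le> sqrt (real (N n)) * (real (b + w - 1) / real (N n))"
    by (intro mult_right_mono sum_heads_below_le pos) auto
  also have "\<dots> = real (b + w - 1) / sqrt (real (N n))"
    using pos by (simp add: field_simps)
  finally show ?thesis .
qed

lemma tied_probability_limit:
  assumes "w < b" "w \<ge> 1"
  shows "(\<lambda>n. urn_mean b w n (\<lambda>h. of_bool (tied b w n h))) \<longlonglongrightarrow> tie_chance b w"
proof -
  define r where "r n = urn_mean b w n (\<lambda>h. of_bool (\<not> tied b w n h) *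
      tie_chance (balls b Black h n) (balls w White h n))" for n
  have split: "urn_mean b w n (\<lambda>h. of_bool (tied b w n h)) = tie_chance b w - r n" for n
  proof -
    have "stopped_chance b w n = (\<lambda>h. of_bool (tied b w n h) + of_bool (\<not> tied b w n h) *
        tie_chance (balls b Black h n) (balls w White h n))"
      by (auto simp: stopped_chance_def fun_eq_iff)
    then show ?thesis
      using stopped_chance_martingale[OF assms, of n] by (simp add: urn_mean_add r_def)
  qed
  have r_nonneg: "r n \<ge> 0" for n
    unfolding r_def urn_mean_def
    by (intro sum_nonneg mult_nonneg_nonneg urn_weight_nonneg tie_chance_nonneg) auto
  have r_le: "r n \<le> real (b + w - 1) / sqrt (real (b + w + n - 1))" for n
    unfolding r_def by (rule urn_mean_untied_le[OF assms])
  have "(\<lambda>n. real (b + w - 1) / sqrt (real (b + w + n - 1))) \<longlonglongrightarrow> 0"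
  proof (rule tendsto_divide_0[OF tendsto_const])
    have "filterlim (\<lambda>n. b + w + n - 1) at_top sequentially"
      by (rule filterlim_at_top_mono[OF filterlim_ident]) (use assms in \<open>auto intro!: always_eventually\<close>)
    then have "filterlim (\<lambda>n. sqrt (real (b + w + n - 1))) at_top sequentially"
      by (intro filterlim_compose[OF sqrt_at_top] filterlim_compose[OF filterlim_real_sequentially])
    then show "filterlim (\<lambda>n. sqrt (real (b + w + n - 1))) at_infinity sequentially"
      by (rule filterlim_at_top_imp_at_infinity)
  qed
  then have "r \<longlonglongrightarrow> 0"
    using tendsto_sandwich[of "\<lambda>_. 0" r sequentially, OF _ _ tendsto_const] r_nonneg r_le
    by (metis (no_types, lifting) always_eventually)
  from tendsto_diff[OF tendsto_const this] show ?thesis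
    unfolding split by simp
qed


section \<open>From the urn to its finite histories\<close>

context polya_urn
begin

definition cylinder :: "nat \<Rightarrow> (nat \<Rightarrow> colour) \<Rightarrow> 'a set" where
  "cylinder n h = {x \<in> space M. \<forall>i<n. D i x = h i}"

lemma draw_event: "{x \<in> space M. D n x = c} \<in> sets M"
proof -
  have "D n -` {c} \<inter> space M \<in> sets M"
    using draw_measurable[of n] by (rule measurable_sets) auto
  also have "D n -` {c} \<inter> space M = {x \<in> space M. D n x = c}" by auto
  finally show ?thesis .
qed

lemma cylinder_event: "cylinder n h \<in> sets M"
  unfolding cylinder_def
  by (intro sets.sets_Collect_countable_All sets.sets_Collect_imp sets.sets_Collect_const draw_event)

text \<open>The laws of the draws are conditional on histories of positive probability. Once a history has
  probability zero, so has each of its continuations, and the product on the right already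
  contains a factor zero.\<close>

lemma prob_cylinder: "prob (cylinder n h) = urn_weight b w n h"
proof (induction n)
  case 0
  then show ?case by (simp add: cylinder_def prob_space)
next
  case (Suc n)
  have eq: "cylinder (Suc n) h = {x \<in> space M. D n x = h n \<and> (\<forall>i<n. D i x = h i)}"
    by (auto simp: cylinder_def less_Suc_eq)
  show ?case
  proof (cases "prob (cylinder n h) > 0")
    case True
    let ?k = "if h n = Black then b else w"
    have "\<P>(x in M. D n x = h n \<bar> \<forall>i<n. D i x = h i) = real (balls ?k (h n) h n) / real (b + w + n)"
      using draw_black[of n h] draw_white[of n h] True by (cases "h n") (auto simp: cylinder_def)
    then have "prob (cylinder (Suc n) h) / prob (cylinder n h)
        = real (balls ?k (h n) h n) / real (b + w + n)"
      unfolding eq by (simp add: cond_prob_def cylinder_def)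
    then show ?thesis using True Suc.IH by (simp add: field_simps)
  next
    case False
    have "prob (cylinder (Suc n) h) \<le> prob (cylinder n h)"
      by (intro finite_measure_mono cylinder_event) (auto simp: cylinder_def)
    with False have "prob (cylinder (Suc n) h) = 0" "prob (cylinder n h) = 0"
      by (simp_all add: measure_le_0_iff not_less)
    then show ?thesis using Suc.IH by simp
  qed
qed

lemma history_event_eq:
  assumes "determined_by n Q"
  shows "{x \<in> space M. Q (\<lambda>i. D i x)} = (\<Union>h\<in>{h \<in> histories n. Q h}. cylinder n h)"
proof (intro equalityI subsetI)
  fix x assume x: "x \<in> {x \<in> space M. Q (\<lambda>i. D i x)}"
  let ?h = "restrict (\<lambda>i. D i x) {..<n}"
  have "Q ?h = Q (\<lambda>i. D i x)" using assms unfolding determined_by_def by simp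
  then have "?h \<in> {h \<in> histories n. Q h}" using x by (auto simp: histories_def)
  moreover have "x \<in> cylinder n ?h" using x by (auto simp: cylinder_def)
  ultimately show "x \<in> (\<Union>h\<in>{h \<in> histories n. Q h}. cylinder n h)" by blast
next
  fix x assume "x \<in> (\<Union>h\<in>{h \<in> histories n. Q h}. cylinder n h)"
  then obtain h where h: "Q h" "x \<in> cylinder n h" by auto
  have "\<forall>i<n. D i x = h i" using h by (simp add: cylinder_def)
  with assms have "Q (\<lambda>i. D i x) = Q h" by (simp add: determined_by_def)
  then show "x \<in> {x \<in> space M. Q (\<lambda>i. D i x)}" using h by (auto simp: cylinder_def)
qed

lemma history_event:
  assumes "determined_by n Q"
  shows "{x \<in> space M. Q (\<lambda>i. D i x)} \<in> sets M"
  unfolding history_event_eq[OF assms]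
  by (intro sets.finite_UN cylinder_event) (auto simp: finite_histories)

lemma prob_history:
  assumes "determined_by n Q"
  shows "\<P>(x in M. Q (\<lambda>i. D i x)) = urn_mean b w n (\<lambda>h. of_bool (Q h))"
proof -
  have disj: "disjoint_family_on (cylinder n) {h \<in> histories n. Q h}"
  proof (unfold disjoint_family_on_def, intro ballI impI)
    fix h h' assume "h \<in> {h \<in> histories n. Q h}" "h' \<in> {h \<in> histories n. Q h}" "h \<noteq> h'"
    then obtain i where "i < n" "h i \<noteq> h' i"
      unfolding histories_def by (metis (no_types, lifting) PiE_ext lessThan_iff mem_Collect_eq)
    then show "cylinder n h \<inter> cylinder n h' = {}" by (auto simp: cylinder_def)
  qed
  have "\<P>(x in M. Q (\<lambda>i. D i x)) = (\<Sum>h\<in>{h \<in> histories n. Q h}. prob (cylinder n h))"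
    unfolding history_event_eq[OF assms] using disj
    by (intro measure_finite_Union) (auto simp: finite_histories cylinder_event)
  also have "\<dots> = (\<Sum>h\<in>histories n. if Q h then urn_weight b w n h else 0)"
    by (simp add: prob_cylinder sum.inter_filter finite_histories)
  also have "\<dots> = urn_mean b w n (\<lambda>h. of_bool (Q h))"
    unfolding urn_mean_def by (intro sum.cong) auto
  finally show ?thesis .
qed

lemma prob_ever_tied:
  assumes "w < b" "w \<ge> 1"
  shows "\<P>(x in M. \<exists>n. black_balls b D n x = white_balls w D n x) = tie_chance b w"
proof -
  define A where "A n = {x \<in> space M. tied b w n (\<lambda>i. D i x)}" for n
  have "range A \<subseteq> sets M"
    unfolding A_def using history_event[OF determined_by_tied] by blast
  moreover have "incseq A"
    unfolding A_def by (rule incseq_SucI) (auto simp: tied_Suc)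
  ultimately have "(\<lambda>n. prob (A n)) \<longlonglongrightarrow> prob (\<Union>n. A n)"
    by (rule finite_Lim_measure_incseq)
  moreover have "prob (A n) = urn_mean b w n (\<lambda>h. of_bool (tied b w n h))" for n
    unfolding A_def by (rule prob_history[OF determined_by_tied])
  ultimately have "prob (\<Union>n. A n) = tie_chance b w"
    using tied_probability_limit[OF assms] LIMSEQ_unique by simp
  moreover have "(\<Union>n. A n) = {x \<in> space M. \<exists>n. black_balls b D n x = white_balls w D n x}"
    by (auto simp: A_def tied_def black_balls_def white_balls_def)
  ultimately show ?thesis by simp
qed

end

theorem mainTheorem2:
  fixes M :: "'a measure" and b w :: nat and D :: "nat \<Rightarrow> 'a \<Rightarrow> colour"
  assumes "b > w" and "w \<ge> 1"
    and "polya_urn M b w D"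
  shows "\<P>(x in M. \<exists>n. black_balls b D n x = white_balls w D n x) =
    2 * \<P>(t in fair_tosses (b + w - 1). card {i. i < b + w - 1 \<and> t i} \<le> w - 1)"
  using polya_urn.prob_ever_tied[OF assms(3,1,2)] prob_fair_tosses[OF assms(2)]
  by (simp add: tie_chance_def)

end
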